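(* Let $\mathcal{G}=(V,E)$ be a finite connected undirected graph with $|V|\ge 2$, conductances $c:E\to\mathbb{R}_{>0}$ and a marked vertex $b\in V$. Let $\Sigma$ be the floating component of a $\mathbb{P}$-random two-component spanning forest of $\mathcal{G}$. Then for every vertex $u$, the probability that $u$ is in $\Sigma$ is $$\mathbb{P}(u\in\Sigma)=\frac{\kappa}{\kappa_2}\,G_{u,u},$$ and for any two vertices $u,v$, the probability that both $u$ and $v$ are in $\Sigma$ is $$\mathbb{P}(u\in\Sigma,\ v\in\Sigma)=\frac{\kappa}{\kappa_2}\,G_{u,v}.$$
   Context: A spanning tree of $\mathcal{G}$ is a connected acyclic subgraph $(V,A)$, $A\subseteq E$. A two-component spanning forest (2SF) is an acyclic subgraph $(V,B)$, $B\subseteq E$, with exactly two connected components (a component may be a single vertex). The weight of a subgraph is the product of the conductances $c(e)$ of its edges. $\kappa$ is the sum of the weights of all spanning trees of $\mathcal{G}$, and $\kappa_2$ is the sum of the weights of all 2SFs of $\mathcal{G}$. $\mathbb{P}$ is the probability measure on 2SFs giving each 2SF probability proportional to its weight. The floating component of a 2SF is (the vertex set of) the component not containing $b$. The Laplacian is $\Delta f(v)=\sum_{v'\sim v}c_{vv'}(f(v)-f(v'))$ on $\mathbb{R}^V$. The Dirichlet Laplacian $\Delta_D$ on $\mathbb{R}^{V\setminus\{b\}}$ is the matrix obtained from $\Delta$ by deleting the row and column of $b$; it is invertible. The Green's function is $G=\Delta_D^{-1}$, extended by $G_{u,v}=0$ if $u=b$ or $v=b$. *)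

theory Defs
  imports "HOL-Probability.Probability"
begin

section \<open>Finite simple graphs\<close>

text \<open>An undirected simple graph is a vertex set \<open>V\<close> with a set \<open>E\<close> of two-element subsets of \<open>V\<close>.
  A spanning subgraph \<open>(V, B)\<close> is represented by its edge set \<open>B \<subseteq> E\<close>.\<close>

definition finite_simple_graph :: "'a set \<Rightarrow> 'a set set \<Rightarrow> bool" where
  "finite_simple_graph V E \<longleftrightarrow> finite V \<and> (\<forall>e\<in>E. e \<subseteq> V \<and> card e = 2)"

definition adjacency :: "'a set set \<Rightarrow> 'a rel" where
  "adjacency B = {(x, y). {x, y} \<in> B}"

definition connection :: "'a set \<Rightarrow> 'a set set \<Rightarrow> 'a rel" where
  "connection V B = {(x, y) \<in> V \<times> V. (x, y) \<in> (adjacency B)\<^sup>*}"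

definition components_of :: "'a set \<Rightarrow> 'a set set \<Rightarrow> 'a set set" where
  "components_of V B = V // connection V B"

definition connected_graph :: "'a set \<Rightarrow> 'a set set \<Rightarrow> bool" where
  "connected_graph V B \<longleftrightarrow> V \<noteq> {} \<and> (\<forall>x\<in>V. \<forall>y\<in>V. (x, y) \<in> (adjacency B)\<^sup>*)"

text \<open>A cycle is given by the list of its distinct vertices, the last one being adjacent to the
  first one. In a simple graph it has length at least 3.\<close>

definition is_cycle :: "'a set set \<Rightarrow> 'a list \<Rightarrow> bool" where
  "is_cycle B p \<longleftrightarrow> length p \<ge> 3 \<and> distinct p \<and>
     (\<forall>i<length p. {p ! i, p ! (Suc i mod length p)} \<in> B)"

definition acyclic_graph :: "'a set set \<Rightarrow> bool" where
  "acyclic_graph B \<longleftrightarrow> (\<nexists>p. is_cycle B p)"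


section \<open>Spanning trees and two-component spanning forests\<close>

definition spanning_trees :: "'a set \<Rightarrow> 'a set set \<Rightarrow> 'a set set set" where
  "spanning_trees V E = {A. A \<subseteq> E \<and> connected_graph V A \<and> acyclic_graph A}"

definition two_forests :: "'a set \<Rightarrow> 'a set set \<Rightarrow> 'a set set set" where
  "two_forests V E = {B. B \<subseteq> E \<and> acyclic_graph B \<and> card (components_of V B) = 2}"

definition weight :: "('a set \<Rightarrow> real) \<Rightarrow> 'a set set \<Rightarrow> real" where
  "weight c B = (\<Prod>e\<in>B. c e)"

definition kappa :: "'a set \<Rightarrow> 'a set set \<Rightarrow> ('a set \<Rightarrow> real) \<Rightarrow> real" where
  "kappa V E c = (\<Sum>A\<in>spanning_trees V E. weight c A)"

definition kappa2 :: "'a set \<Rightarrow> 'a set set \<Rightarrow> ('a set \<Rightarrow> real) \<Rightarrow> real" where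
  "kappa2 V E c = (\<Sum>B\<in>two_forests V E. weight c B)"

definition two_forest_measure ::
  "'a set \<Rightarrow> 'a set set \<Rightarrow> ('a set \<Rightarrow> real) \<Rightarrow> 'a set set measure" where
  "two_forest_measure V E c =
     point_measure (two_forests V E) (\<lambda>B. ennreal (weight c B / kappa2 V E c))"

text \<open>Meaningful when \<open>b \<in> V\<close> and \<open>B\<close> is a two-component spanning forest: exactly one component
  then avoids \<open>b\<close>.\<close>

definition floating_component :: "'a set \<Rightarrow> 'a \<Rightarrow> 'a set set \<Rightarrow> 'a set" where
  "floating_component V b B = (THE C. C \<in> components_of V B \<and> b \<notin> C)"


section \<open>Laplacian and Green's function\<close>

definition laplacian ::
  "'a set \<Rightarrow> 'a set set \<Rightarrow> ('a set \<Rightarrow> real) \<Rightarrow> ('a \<Rightarrow> real) \<Rightarrow> 'a \<Rightarrow> real" where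
  "laplacian V E c f v = (\<Sum>v'\<in>{v'\<in>V. {v, v'} \<in> E}. c {v, v'} * (f v - f v'))"

text \<open>The \<open>(u, v)\<close> entry is the value at \<open>u\<close> of the Laplacian of the indicator function of \<open>v\<close>.\<close>

definition laplacian_matrix ::
  "'a set \<Rightarrow> 'a set set \<Rightarrow> ('a set \<Rightarrow> real) \<Rightarrow> 'a \<Rightarrow> 'a \<Rightarrow> real" where
  "laplacian_matrix V E c u v = laplacian V E c (indicator {v}) u"

text \<open>Matrices with rows and columns indexed by a finite set \<open>I\<close> are functions of two arguments of
  which only the values on \<open>I \<times> I\<close> matter; deleting rows and columns means shrinking \<open>I\<close>.
  The vanishing outside \<open>I \<times> I\<close> serves only to make the inverse unique as a function.\<close>

definition is_inverse_on :: "'a set \<Rightarrow> ('a \<Rightarrow> 'a \<Rightarrow> real) \<Rightarrow> ('a \<Rightarrow> 'a \<Rightarrow> real) \<Rightarrow> bool" where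
  "is_inverse_on I A N \<longleftrightarrow>
     (\<forall>i\<in>I. \<forall>j\<in>I. (\<Sum>k\<in>I. A i k * N k j) = (if i = j then 1 else 0)) \<and>
     (\<forall>i\<in>I. \<forall>j\<in>I. (\<Sum>k\<in>I. N i k * A k j) = (if i = j then 1 else 0))"

definition inverse_on :: "'a set \<Rightarrow> ('a \<Rightarrow> 'a \<Rightarrow> real) \<Rightarrow> 'a \<Rightarrow> 'a \<Rightarrow> real" where
  "inverse_on I A =
     (THE N. is_inverse_on I A N \<and> (\<forall>i j. i \<notin> I \<or> j \<notin> I \<longrightarrow> N i j = 0))"

definition green ::
  "'a set \<Rightarrow> 'a set set \<Rightarrow> ('a set \<Rightarrow> real) \<Rightarrow> 'a \<Rightarrow> 'a \<Rightarrow> 'a \<Rightarrow> real" where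
  "green V E c b u v =
     (if u = b \<or> v = b then 0 else inverse_on (V - {b}) (laplacian_matrix V E c) u v)"


section \<open>Well-definedness\<close>

lemma is_inverse_on_unique:
  assumes I: "finite I" and N: "is_inverse_on I A N" and M: "is_inverse_on I A M"
    and ij: "i \<in> I" "j \<in> I"
  shows "N i j = M i j"
proof -
  have "N i j = (\<Sum>k\<in>I. N i k * (if k = j then 1 else 0))"
    using I ij by (simp add: if_distrib cong: if_cong)
  also have "\<dots> = (\<Sum>k\<in>I. N i k * (\<Sum>l\<in>I. A k l * M l j))"
    using M ij by (intro sum.cong) (auto simp: is_inverse_on_def)
  also have "\<dots> = (\<Sum>k\<in>I. \<Sum>l\<in>I. N i k * A k l * M l j)"
    by (simp add: sum_distrib_left mult.assoc)
  also have "\<dots> = (\<Sum>l\<in>I. \<Sum>k\<in>I. N i k * A k l * M l j)"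
    by (rule sum.swap)
  also have "\<dots> = (\<Sum>l\<in>I. (\<Sum>k\<in>I. N i k * A k l) * M l j)"
    by (simp add: sum_distrib_right)
  also have "\<dots> = (\<Sum>l\<in>I. (if i = l then 1 else 0) * M l j)"
    using N ij by (intro sum.cong) (auto simp: is_inverse_on_def)
  also have "\<dots> = M i j"
    using I ij by (simp add: if_distrib[of "\<lambda>x. x * _"] cong: if_cong)
  finally show ?thesis .
qed

lemma inverse_on_eq:
  assumes I: "finite I" and N: "is_inverse_on I A N" and ij: "i \<in> I" "j \<in> I"
  shows "inverse_on I A i j = N i j"
proof -
  define M where "M = (\<lambda>i j. if i \<in> I \<and> j \<in> I then N i j else 0)"
  have M: "is_inverse_on I A M \<and> (\<forall>i j. i \<notin> I \<or> j \<notin> I \<longrightarrow> M i j = 0)"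
    using N by (simp add: is_inverse_on_def M_def cong: sum.cong)
  have "inverse_on I A = M"
    unfolding inverse_on_def
  proof (rule the_equality, rule M)
    fix M' assume M': "is_inverse_on I A M' \<and> (\<forall>i j. i \<notin> I \<or> j \<notin> I \<longrightarrow> M' i j = 0)"
    have "M' i j = M i j" for i j
      using is_inverse_on_unique[OF I, of A M' M i j] M M' by (cases "i \<in> I \<and> j \<in> I") auto
    then show "M' = M" by blast
  qed
  then show ?thesis using ij by (simp add: M_def)
qed

lemma prob_space_two_forest_measure:
  assumes G: "finite_simple_graph V E" and c: "\<And>e. e \<in> E \<Longrightarrow> c e > 0"
    and ne: "two_forests V E \<noteq> {}"
  shows "prob_space (two_forest_measure V E c)"
proof -
  have "E \<subseteq> Pow V" "finite V"
    using G by (auto simp: finite_simple_graph_def)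
  then have "finite E" by (meson finite_Pow_iff finite_subset)
  then have fin: "finite (two_forests V E)"
    by (rule_tac finite_subset[of _ "Pow E"]) (auto simp: two_forests_def)
  have pos: "weight c B > 0" if "B \<in> two_forests V E" for B
    using that c by (auto simp: weight_def two_forests_def intro!: prod_pos)
  have k: "kappa2 V E c > 0"
    unfolding kappa2_def by (rule sum_pos[OF fin ne pos])
  have "(\<Sum>B\<in>two_forests V E. weight c B / kappa2 V E c) = 1"
    using k by (simp add: sum_divide_distrib[symmetric] kappa2_def)
  then show ?thesis
    unfolding two_forest_measure_def using fin pos k
    by (intro prob_space_point_measure) (auto simp: less_imp_le)
qed

end

theory Submission
  imports Defs
begin

text \<open>
  Write \<open>F u v\<close> for the total weight of the two-component spanning forests whose floating
  component contains both \<open>u\<close> and \<open>v\<close> (\<open>floating_weight\<close> below). The probability in question is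
  \<open>F u v / \<kappa>\<^sub>2\<close>, so the theorem says that \<open>F / \<kappa>\<close> is the inverse of the Dirichlet Laplacian. As
  both matrices are symmetric and \<open>F b v = 0\<close>, it suffices to show \<open>\<Delta> F(\<cdot>, v) (u) = \<kappa> [u = v]\<close> for
  \<open>u \<noteq> b\<close>. Invertibility of the Dirichlet Laplacian then comes for free, because \<open>\<kappa> > 0\<close>.

  Expand the left-hand side into a sum over pairs of a neighbour \<open>w\<close> of \<open>u\<close> and a forest \<open>B\<close>. If
  \<open>B\<close> connects \<open>u\<close> and \<open>w\<close>, the pair contributes \<open>0\<close>. Otherwise adding the edge \<open>{u, w}\<close> turns
  \<open>B\<close> into a spanning tree \<open>T\<close> of weight \<open>c {u, w}\<close> times that of \<open>B\<close>, and removing the edge from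
  \<open>T\<close> gives back \<open>B\<close> (\<open>insert_edge_bij_betw\<close>). So the sum becomes one over spanning trees \<open>T\<close> and
  edges \<open>{u, w}\<close> of \<open>T\<close> at \<open>u\<close>. Call the component of \<open>w\<close> in \<open>T - {{u, w}}\<close> the branch of \<open>w\<close>. The
  sign that \<open>(T, w)\<close> contributes is
  \<open>[b in the branch of w] - [v in the branch of w]\<close> (\<open>both_floating_difference\<close>). The branches
  partition the vertices other than \<open>u\<close> (\<open>sum_branches\<close>), so summing over \<open>w\<close> gives
  \<open>[b \<noteq> u] - [v \<noteq> u] = [u = v]\<close>, and summing over \<open>T\<close> gives \<open>\<kappa> [u = v]\<close>.

  The arguments about trees use a form of acyclicity that does not mention cycles: every
  edge is a bridge (\<open>acyclic_graph_iff_all_bridges\<close>).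
\<close>

section \<open>Connectivity\<close>

abbreviation linked :: "'a set set \<Rightarrow> 'a \<Rightarrow> 'a \<Rightarrow> bool" where
  "linked B x y \<equiv> (x, y) \<in> (adjacency B)\<^sup>*"

lemma linked_sym: "linked B x y \<Longrightarrow> linked B y x"
proof -
  have "sym ((adjacency B)\<^sup>*)"
    by (intro sym_rtrancl symI) (auto simp: adjacency_def insert_commute)
  then show "linked B x y \<Longrightarrow> linked B y x" by (auto dest: symD)
qed

lemma linked_trans: "linked B x y \<Longrightarrow> linked B y z \<Longrightarrow> linked B x z"
  by (rule rtrancl_trans)

text \<open>Connectedness becomes an equality of clusters in \<open>linked_iff_cluster\<close>, so that chains of
  symmetry and transitivity reduce to equational reasoning.\<close>

definition cluster :: "'a set set \<Rightarrow> 'a \<Rightarrow> 'a set" where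
  "cluster B x = {y. linked B x y}"

lemma linked_iff_cluster: "linked B x y \<longleftrightarrow> cluster B x = cluster B y"
  unfolding cluster_def by (blast intro: linked_sym linked_trans rtrancl.rtrancl_refl)

lemma linked_mono: "B \<subseteq> B' \<Longrightarrow> linked B x y \<Longrightarrow> linked B' x y"
  using rtrancl_mono[of "adjacency B" "adjacency B'"] by (auto simp: adjacency_def)

lemma linked_edge: "{x, y} \<in> B \<Longrightarrow> linked B x y"
  by (auto simp: adjacency_def)

text \<open>A shortest connection uses the new edge at most once, in one of the two directions.\<close>

lemma linked_insert_iff:
  "linked (insert {u, w} B) x y \<longleftrightarrow>
     linked B x y \<or> linked B x u \<and> linked B w y \<or> linked B x w \<and> linked B u y"
proof -
  have "adjacency (insert {u, w} B) = insert (u, w) (insert (w, u) (adjacency B))"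
    by (auto simp: adjacency_def doubleton_eq_iff)
  then show ?thesis
    by (auto simp: rtrancl_insert intro: rtrancl_trans)
qed

section \<open>Acyclicity means that every edge is a bridge\<close>

definition all_bridges :: "'a set set \<Rightarrow> bool" where
  "all_bridges B \<longleftrightarrow> (\<forall>x y. {x, y} \<in> B \<longrightarrow> \<not> linked (B - {{x, y}}) x y)"

lemma linked_imp_simple_path:
  assumes "linked B x y"
  shows "\<exists>p. p \<noteq> [] \<and> hd p = x \<and> last p = y \<and> distinct p \<and>
           (\<forall>i. Suc i < length p \<longrightarrow> {p ! i, p ! Suc i} \<in> B)"
  using assms
proof (induction rule: rtrancl_induct)
  case base
  show ?case by (rule exI[of _ "[x]"]) auto
next
  case (step y z)
  then obtain p where p: "p \<noteq> []" "hd p = x" "last p = y" "distinct p"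
    "\<And>i. Suc i < length p \<Longrightarrow> {p ! i, p ! Suc i} \<in> B" by blast
  show ?case
  proof (cases "z \<in> set p")
    case True
    then obtain k where k: "k < length p" "p ! k = z" by (auto simp: in_set_conv_nth)
    have "last (take (Suc k) p) = z" using k by (simp add: take_Suc_conv_app_nth)
    then show ?thesis using p k by (intro exI[of _ "take (Suc k) p"]) (auto simp: hd_take)
  next
    case False
    have "{(p @ [z]) ! i, (p @ [z]) ! Suc i} \<in> B" if i: "Suc i < length (p @ [z])" for i
    proof (cases "Suc i < length p")
      case True
      then show ?thesis using p(5)[of i] by (simp add: nth_append)
    next
      case False
      with i have "i = length p - 1" "Suc i = length p" by auto
      then show ?thesis using p(1,3) step.hyps(2)
        by (auto simp: nth_append last_conv_nth adjacency_def)
    qed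
    then show ?thesis using p False by (intro exI[of _ "p @ [z]"]) auto
  qed
qed

text \<open>A simple path joining the ends of an edge that avoids this edge closes up to a cycle;
  conversely, a cycle minus one of its edges still joins the ends of that edge.\<close>

lemma acyclic_graph_iff_all_bridges:
  assumes two: "\<And>e. e \<in> B \<Longrightarrow> card e = 2"
  shows "acyclic_graph B \<longleftrightarrow> all_bridges B"
proof
  assume ac: "acyclic_graph B"
  show "all_bridges B"
    unfolding all_bridges_def
  proof (intro allI impI notI)
    fix x y assume e: "{x, y} \<in> B" and l: "linked (B - {{x, y}}) x y"
    have xy: "x \<noteq> y" using two[OF e] by auto
    obtain p where p: "p \<noteq> []" "hd p = x" "last p = y" "distinct p"
      "\<And>i. Suc i < length p \<Longrightarrow> {p ! i, p ! Suc i} \<in> B - {{x, y}}"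
      using linked_imp_simple_path[OF l] by blast
    have l1: "length p \<noteq> 1" using p(1-3) xy by (auto simp: length_Suc_conv)
    have l2: "length p \<noteq> 2"
    proof
      assume "length p = 2"
      then show False using p(5)[of 0] p(1-3) by (auto simp: hd_conv_nth last_conv_nth)
    qed
    have l3: "length p \<ge> 3" using l1 l2 p(1) by (cases "length p") auto
    have "{p ! i, p ! (Suc i mod length p)} \<in> B" if i: "i < length p" for i
    proof (cases "Suc i < length p")
      case True
      then show ?thesis using p(5)[of i] by auto
    next
      case False
      with i have *: "Suc i = length p" "i = length p - 1" by auto
      then have "p ! i = y" "p ! (Suc i mod length p) = x"
        using p(1-3) by (auto simp: hd_conv_nth last_conv_nth)
      then show ?thesis using e by (simp add: insert_commute)
    qed
    then have "is_cycle B p" using l3 p(4) by (auto simp: is_cycle_def)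
    then show False using ac by (auto simp: acyclic_graph_def)
  qed
next
  assume br: "all_bridges B"
  show "acyclic_graph B"
    unfolding acyclic_graph_def
  proof
    assume "\<exists>p. is_cycle B p"
    then obtain p where l3: "length p \<ge> 3" and d: "distinct p"
      and E: "\<And>i. i < length p \<Longrightarrow> {p ! i, p ! (Suc i mod length p)} \<in> B"
      by (auto simp: is_cycle_def)
    \<comment> \<open>The edge from \<open>p ! 0\<close> to \<open>p ! 1\<close> is bypassed by the rest of the cycle.\<close>
    define e where "e = {p ! 0, p ! 1}"
    have len: "0 < length p" "1 < length p" using l3 by auto
    then have e: "e \<in> B" using E[of 0] by (simp add: e_def)
    have edge: "linked (B - {e}) (p ! i) (p ! (Suc i mod length p))"
      if i: "1 \<le> i" "i < length p" for i
    proof -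
      have "{p ! i, p ! (Suc i mod length p)} \<noteq> e"
      proof (cases "Suc i = length p")
        case True
        then have "i \<noteq> 0" "i \<noteq> 1" using l3 by auto
        then have "p ! i \<noteq> p ! 0" "p ! i \<noteq> p ! 1"
          using nth_eq_iff_index_eq[OF d i(2) len(1)] nth_eq_iff_index_eq[OF d i(2) len(2)] by auto
        then show ?thesis by (auto simp: e_def doubleton_eq_iff)
      next
        case False
        then have "Suc i mod length p = Suc i" using i by auto
        then have "p ! (Suc i mod length p) \<noteq> p ! 0" "p ! (Suc i mod length p) \<noteq> p ! 1"
          using nth_eq_iff_index_eq[OF d _ len(1), of "Suc i"]
            nth_eq_iff_index_eq[OF d _ len(2), of "Suc i"] i False by auto
        then show ?thesis by (auto simp: e_def doubleton_eq_iff)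
      qed
      then show ?thesis using E[OF i(2)] by (intro linked_edge) auto
    qed
    have path: "linked (B - {e}) (p ! 1) (p ! Suc k)" if "Suc k < length p" for k
      using that
    proof (induction k)
      case (Suc k)
      then show ?case using edge[of "Suc k"] by (auto intro: linked_trans[of "p ! 1" "p ! Suc k"])
    qed simp
    have "linked (B - {e}) (p ! 1) (p ! (length p - 1))"
      using path[of "length p - 2"] l3 by (simp add: Suc_diff_le numeral_2_eq_2 Suc_diff_Suc)
    moreover have "linked (B - {e}) (p ! (length p - 1)) (p ! 0)"
      using edge[of "length p - 1"] len by simp
    ultimately have "linked (B - {e}) (p ! 0) (p ! 1)"
      by (simp add: linked_iff_cluster)
    then show False using br e by (auto simp: all_bridges_def e_def)
  qed
qed

lemma all_bridges_mono:
  assumes "all_bridges B" "A \<subseteq> B"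
  shows "all_bridges A"
  unfolding all_bridges_def
proof (intro allI impI notI)
  fix x y assume e: "{x, y} \<in> A" and l: "linked (A - {{x, y}}) x y"
  have "A - {{x, y}} \<subseteq> B - {{x, y}}" using assms(2) by blast
  then have "linked (B - {{x, y}}) x y" using l by (rule linked_mono)
  then show False using assms e by (auto simp: all_bridges_def)
qed

text \<open>If an old edge \<open>{x, y}\<close> stopped being a bridge, the detour around it would use the new edge;
  the rest of the detour together with \<open>{x, y}\<close> would then have linked \<open>u\<close> and \<open>w\<close> already in
  \<open>B\<close>.\<close>

lemma all_bridges_insert:
  assumes br: "all_bridges B" and uw: "\<not> linked B u w"
  shows "all_bridges (insert {u, w} B)"
  unfolding all_bridges_def
proof (intro allI impI notI)
  fix x y assume e: "{x, y} \<in> insert {u, w} B"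
    and l: "linked (insert {u, w} B - {{x, y}}) x y"
  show False
  proof (cases "{x, y} = {u, w}")
    case True
    have "{u, w} \<notin> B" using uw linked_edge[of u w B] by blast
    then have "insert {u, w} B - {{x, y}} = B" using True by auto
    then show False using l True uw by (auto simp: doubleton_eq_iff linked_iff_cluster)
  next
    case False
    with e have e': "{x, y} \<in> B" by auto
    define B' where "B' = B - {{x, y}}"
    have "insert {u, w} B - {{x, y}} = insert {u, w} B'" using False by (auto simp: B'_def)
    moreover have "\<not> linked B' x y" using br e' by (auto simp: all_bridges_def B'_def)
    ultimately have "linked B' x u \<and> linked B' w y \<or> linked B' x w \<and> linked B' u y"
      using l by (simp add: linked_insert_iff)
    then have "linked B x u \<and> linked B w y \<or> linked B x w \<and> linked B u y"
      using linked_mono[of B' B] by (auto simp: B'_def)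
    then show False using uw linked_edge[OF e'] unfolding linked_iff_cluster by metis
  qed
qed

text \<open>In a connected spanning subgraph with the fewest edges no edge can be dropped, so all edges
  are bridges.\<close>

lemma spanning_tree_exists:
  assumes fin: "finite E" and two: "\<And>e. e \<in> E \<Longrightarrow> card e = 2" and conn: "connected_graph V E"
  shows "spanning_trees V E \<noteq> {}"
proof -
  obtain A where A: "A \<subseteq> E" "connected_graph V A"
    and min: "\<And>A'. A' \<subseteq> E \<Longrightarrow> connected_graph V A' \<Longrightarrow> card A \<le> card A'"
    using ex_has_least_nat[of "\<lambda>A. A \<subseteq> E \<and> connected_graph V A" E card] conn by auto
  have "all_bridges A"
    unfolding all_bridges_def
  proof (intro allI impI notI)
    fix x y assume e: "{x, y} \<in> A" and l: "linked (A - {{x, y}}) x y"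
    have "linked A r s \<longleftrightarrow> linked (insert {x, y} (A - {{x, y}})) r s" for r s
      using e by (simp add: insert_absorb)
    then have "linked A r s \<longleftrightarrow> linked (A - {{x, y}}) r s" for r s
      unfolding linked_insert_iff using l unfolding linked_iff_cluster by metis
    then have "connected_graph V (A - {{x, y}})" using A(2) by (auto simp: connected_graph_def)
    moreover have "card (A - {{x, y}}) < card A"
      using e A(1) fin by (meson card_Diff1_less finite_subset)
    ultimately show False using min[of "A - {{x, y}}"] A(1) by auto
  qed
  then have "A \<in> spanning_trees V E"
    using A two by (auto simp: spanning_trees_def acyclic_graph_iff_all_bridges subset_iff)
  then show ?thesis by blast
qed

section \<open>Two components seen from the marked vertex\<close>

text \<open>Fixing \<open>b\<close> turns the count of components into two statements about connectedness: some vertex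
  is not linked to \<open>b\<close>, and all such vertices form a single component.\<close>

lemma card_components_eq_2_iff:
  assumes b: "b \<in> V"
  shows "card (components_of V B) = 2 \<longleftrightarrow>
    (\<exists>s\<in>V. \<not> linked B b s) \<and>
    (\<forall>x\<in>V. \<forall>y\<in>V. \<not> linked B b x \<longrightarrow> \<not> linked B b y \<longrightarrow> linked B x y)"
proof -
  define K where "K x = {y \<in> V. linked B x y}" for x
  have comps: "components_of V B = K ` V"
    by (auto simp: components_of_def quotient_def connection_def K_def)
  have K_eq: "K x = K y \<longleftrightarrow> linked B x y" if "x \<in> V" "y \<in> V" for x y
    using that unfolding K_def linked_iff_cluster by blast
  show ?thesis
  proof (intro iffI conjI)
    assume "card (components_of V B) = 2"
    then obtain C D where CD: "K ` V = {C, D}" "C \<noteq> D"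
      by (auto simp: card_2_iff comps)
    then have "\<exists>s\<in>V. K s \<noteq> K b" by (metis image_iff insertCI)
    then show "\<exists>s\<in>V. \<not> linked B b s" using K_eq b by metis
    have "K x \<noteq> K b \<Longrightarrow> K y \<noteq> K b \<Longrightarrow> K x = K y" if "x \<in> V" "y \<in> V" for x y
      using CD that b by (metis imageI insertE singletonD)
    then show "\<forall>x\<in>V. \<forall>y\<in>V. \<not> linked B b x \<longrightarrow> \<not> linked B b y \<longrightarrow> linked B x y"
      using K_eq b by metis
  next
    assume *: "(\<exists>s\<in>V. \<not> linked B b s) \<and>
      (\<forall>x\<in>V. \<forall>y\<in>V. \<not> linked B b x \<longrightarrow> \<not> linked B b y \<longrightarrow> linked B x y)"
    then obtain s where s: "s \<in> V" "\<not> linked B b s" by blast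
    then have "K x \<in> {K b, K s}" if "x \<in> V" for x
      using * K_eq b that by (metis insertCI)
    then have "K ` V = {K b, K s}" using s b by blast
    moreover have "K b \<noteq> K s" using K_eq b s by blast
    ultimately show "card (components_of V B) = 2" by (simp add: comps)
  qed
qed

lemma floating_component_eq:
  assumes b: "b \<in> V" and two: "card (components_of V B) = 2"
  shows "floating_component V b B = {x \<in> V. \<not> linked B b x}"
proof -
  note * = two[unfolded card_components_eq_2_iff[OF b]]
  then obtain s where s: "s \<in> V" "\<not> linked B b s" by blast
  define C where "C = {x \<in> V. \<not> linked B b x}"
  have cls: "connection V B `` {x} = C" if "x \<in> V" "\<not> linked B b x" for x
    using * that unfolding C_def connection_def linked_iff_cluster by auto
  show ?thesis
    unfolding floating_component_def C_def[symmetric]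
  proof (rule the_equality)
    have "C \<in> components_of V B"
      using cls[OF s] s(1) by (auto simp: components_of_def quotient_def)
    then show "C \<in> components_of V B \<and> b \<notin> C" by (simp add: C_def)
  next
    fix D assume D: "D \<in> components_of V B \<and> b \<notin> D"
    then obtain x where x: "x \<in> V" "D = connection V B `` {x}"
      by (auto simp: components_of_def quotient_def)
    have "\<not> linked B b x" using D x b by (auto simp: connection_def dest: linked_sym)
    then show "D = C" using cls x by blast
  qed
qed

section \<open>Branches of a tree\<close>

lemma linked_endpoint_of_removed_edge:
  assumes "linked T x u" "{u, w} \<in> T"
  shows "linked (T - {{u, w}}) x u \<or> linked (T - {{u, w}}) x w"
proof -
  have "linked (insert {u, w} (T - {{u, w}})) x u" using assms by (simp add: insert_absorb)
  then show ?thesis unfolding linked_insert_iff by blast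
qed

text \<open>Here and below, the branch of a neighbour \<open>w\<close> of \<open>u\<close> consists of the vertices linked to \<open>w\<close>
  once the edge \<open>{u, w}\<close> is removed. Following a walk from \<open>u\<close> to \<open>x\<close>, the branch that contains the
  current vertex changes only when the walk returns to \<open>u\<close>.\<close>

lemma branch_exists:
  assumes "linked T u x" "x \<noteq> u"
  shows "\<exists>w. {u, w} \<in> T \<and> linked (T - {{u, w}}) w x"
  using assms
proof (induction rule: rtrancl_induct)
  case (step y z)
  have yz: "{y, z} \<in> T" using step.hyps(2) by (auto simp: adjacency_def)
  show ?case
  proof (cases "y = u")
    case True
    then show ?thesis using yz by auto
  next
    case False
    then obtain w where w: "{u, w} \<in> T" "linked (T - {{u, w}}) w y" using step.IH by blast
    have "linked (T - {{u, w}}) y z"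
      using yz False step.prems by (intro linked_edge) (auto simp: doubleton_eq_iff)
    then show ?thesis using w linked_trans[of w y _ z] by blast
  qed
qed simp

text \<open>Otherwise \<open>x\<close> could be reached from \<open>u\<close> through \<open>w\<close> and also through \<open>w'\<close>, and one of the two
  edges would not be a bridge. The proof removes both edges and puts \<open>{u, w}\<close> back.\<close>

lemma branch_unique:
  assumes br: "all_bridges T" and w: "{u, w} \<in> T" "linked (T - {{u, w}}) w x"
    and w': "{u, w'} \<in> T" "linked (T - {{u, w'}}) w' x"
  shows "w = w'"
proof (rule ccontr)
  assume ne: "w \<noteq> w'"
  define S where "S = T - {{u, w}} - {{u, w'}}"
  have nb: "\<not> linked (T - {{u, w}}) u w" "\<not> linked (T - {{u, w'}}) u w'"
    using br w(1) w'(1) by (auto simp: all_bridges_def)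
  have S: "S \<subseteq> T - {{u, w}}" "S \<subseteq> T - {{u, w'}}" by (auto simp: S_def)
  have "T - {{u, w'}} = insert {u, w} S" using w(1) ne by (auto simp: S_def doubleton_eq_iff)
  then have "linked S w' x \<or> linked S w' u \<and> linked S w x \<or> linked S w' w \<and> linked S u x"
    using w'(2) by (simp add: linked_insert_iff)
  moreover have "\<not> linked S w' x"
  proof
    assume "linked S w' x"
    then have "linked (T - {{u, w}}) w' x" by (rule linked_mono[OF S(1)])
    moreover have "linked (T - {{u, w}}) u w'"
      using w'(1) ne by (intro linked_edge) (auto simp: doubleton_eq_iff)
    ultimately show False using nb(1) w(2) unfolding linked_iff_cluster by metis
  qed
  moreover have "\<not> linked S w' u" using nb(2) linked_mono[OF S(2), of w' u] linked_sym[of w' u S]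
      linked_sym[of w' u "T - {{u, w'}}"] by blast
  moreover have "\<not> linked S u x"
  proof
    assume "linked S u x"
    then have "linked (T - {{u, w}}) u x" by (rule linked_mono[OF S(1)])
    then show False using nb(1) w(2) unfolding linked_iff_cluster by metis
  qed
  ultimately show False by blast
qed

lemma sum_branches:
  assumes br: "all_bridges T" and x: "linked T u x" and fin: "finite {w. {u, w} \<in> T}"
  shows "(\<Sum>w\<in>{w. {u, w} \<in> T}. of_bool (linked (T - {{u, w}}) w x)) = (of_bool (x \<noteq> u) :: real)"
proof (cases "x = u")
  case True
  have "\<not> linked (T - {{u, w}}) w u" if "{u, w} \<in> T" for w
    using br that linked_sym[of w u "T - {{u, w}}"] by (auto simp: all_bridges_def)
  then show ?thesis using True by simp
next
  case False
  then obtain w where w: "{u, w} \<in> T" "linked (T - {{u, w}}) w x"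
    using branch_exists[OF x] by blast
  have only: "linked (T - {{u, w'}}) w' x \<longleftrightarrow> w' = w" if "{u, w'} \<in> T" for w'
    using branch_unique[OF br w that] w(2) by blast
  have "(\<Sum>w'\<in>{w'. {u, w'} \<in> T}. of_bool (linked (T - {{u, w'}}) w' x))
      = (\<Sum>w'\<in>{w'. {u, w'} \<in> T}. if w' = w then 1 else (0 :: real))"
    by (intro sum.cong) (auto simp: only)
  then show ?thesis using w fin False by simp
qed


section \<open>The Dirichlet problem for the floating component\<close>

locale network =
  fixes V :: "'a set" and E :: "'a set set" and c :: "'a set \<Rightarrow> real" and b :: 'a
  assumes graph: "finite_simple_graph V E"
    and connected: "connected_graph V E"
    and conductance_pos: "\<And>e. e \<in> E \<Longrightarrow> c e > 0"
    and marked: "b \<in> V"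
begin

lemma finite_V: "finite V" and card_edge: "e \<in> E \<Longrightarrow> card e = 2"
  and edge_subset: "e \<in> E \<Longrightarrow> e \<subseteq> V"
  using graph by (auto simp: finite_simple_graph_def)

lemma finite_E: "finite E"
  using edge_subset finite_V by (auto intro: finite_subset[of E "Pow V"])

lemma finite_spanning_trees: "finite (spanning_trees V E)"
  and finite_two_forests: "finite (two_forests V E)"
  using finite_E by (auto intro: finite_subset[of _ "Pow E"] simp: spanning_trees_def two_forests_def)

lemma weight_pos: "B \<subseteq> E \<Longrightarrow> weight c B > 0"
  using conductance_pos by (auto simp: weight_def intro!: prod_pos)

lemma kappa_pos: "kappa V E c > 0"
  unfolding kappa_def
proof (rule sum_pos)
  show "spanning_trees V E \<noteq> {}"
    using spanning_tree_exists finite_E card_edge connected by blast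
qed (use finite_spanning_trees weight_pos in \<open>auto simp: spanning_trees_def\<close>)

lemma acyclic_iff: "B \<subseteq> E \<Longrightarrow> acyclic_graph B \<longleftrightarrow> all_bridges B"
  using card_edge by (auto intro!: acyclic_graph_iff_all_bridges)

lemma spanning_tree_iff:
  "T \<in> spanning_trees V E \<longleftrightarrow> T \<subseteq> E \<and> all_bridges T \<and> (\<forall>x\<in>V. linked T b x)"
proof -
  have "connected_graph V T \<longleftrightarrow> (\<forall>x\<in>V. linked T b x)"
    unfolding connected_graph_def linked_iff_cluster using marked by (metis empty_iff)
  then show ?thesis by (auto simp: spanning_trees_def acyclic_iff)
qed

lemma two_forest_iff:
  "B \<in> two_forests V E \<longleftrightarrow> B \<subseteq> E \<and> all_bridges B \<and> (\<exists>s\<in>V. \<not> linked B b s) \<and>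
     (\<forall>x\<in>V. \<forall>y\<in>V. \<not> linked B b x \<longrightarrow> \<not> linked B b y \<longrightarrow> linked B x y)"
  using card_components_eq_2_iff[OF marked] by (auto simp: two_forests_def acyclic_iff)

text \<open>Removing an edge from a spanning tree leaves exactly two components, one at each end of the
  edge.\<close>

lemma tree_minus_edge_dichotomy:
  assumes T: "T \<in> spanning_trees V E" and e: "{u, w} \<in> T" and x: "x \<in> V"
  shows "linked (T - {{u, w}}) u x \<noteq> linked (T - {{u, w}}) w x"
proof -
  have uV: "u \<in> V" using T e edge_subset by (auto simp: spanning_tree_iff)
  have "linked T x u" using T uV x unfolding spanning_tree_iff linked_iff_cluster by metis
  then have "linked (T - {{u, w}}) u x \<or> linked (T - {{u, w}}) w x"
    using linked_endpoint_of_removed_edge[OF _ e] unfolding linked_iff_cluster by metis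
  moreover have "\<not> linked (T - {{u, w}}) u w"
    using T e by (auto simp: spanning_tree_iff all_bridges_def)
  ultimately show ?thesis unfolding linked_iff_cluster by metis
qed

text \<open>This is the only exchange between forests and trees: a forest together with an edge joining
  its two components is the same as a spanning tree together with one of its edges.\<close>

lemma insert_edge_bij_betw:
  assumes e: "{u, w} \<in> E"
  shows "bij_betw (insert {u, w}) {B \<in> two_forests V E. \<not> linked B u w}
           {T \<in> spanning_trees V E. {u, w} \<in> T}"
proof (rule bij_betw_byWitness[where f' = "\<lambda>T. T - {{u, w}}"])
  show "\<forall>B\<in>{B \<in> two_forests V E. \<not> linked B u w}. insert {u, w} B - {{u, w}} = B"
    using linked_edge[of u w] by auto
  show "\<forall>T\<in>{T \<in> spanning_trees V E. {u, w} \<in> T}. insert {u, w} (T - {{u, w}}) = T"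
    by auto
  have uwV: "u \<in> V" "w \<in> V" using edge_subset e by auto
  show "insert {u, w} ` {B \<in> two_forests V E. \<not> linked B u w}
      \<subseteq> {T \<in> spanning_trees V E. {u, w} \<in> T}"
  proof clarify
    fix B assume B: "B \<in> two_forests V E" and uw: "\<not> linked B u w"
    have "linked (insert {u, w} B) b x" if x: "x \<in> V" for x
    proof (cases "linked B b x")
      case False
      have one: "linked B b u \<and> \<not> linked B b w \<or> linked B b w \<and> \<not> linked B b u"
        using B uw uwV unfolding two_forest_iff linked_iff_cluster by metis
      then have "linked B b u \<and> linked B w x \<or> linked B b w \<and> linked B u x"
        using B uwV x False unfolding two_forest_iff by blast
      then show ?thesis by (auto simp: linked_insert_iff)
    qed (auto simp: linked_insert_iff)
    then show "insert {u, w} B \<in> spanning_trees V E \<and> {u, w} \<in> insert {u, w} B"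
      using B e all_bridges_insert[OF _ uw] by (auto simp: spanning_tree_iff two_forest_iff)
  qed
  show "(\<lambda>T. T - {{u, w}}) ` {T \<in> spanning_trees V E. {u, w} \<in> T}
      \<subseteq> {B \<in> two_forests V E. \<not> linked B u w}"
  proof clarify
    fix T assume T: "T \<in> spanning_trees V E" and eT: "{u, w} \<in> T"
    note dich = tree_minus_edge_dichotomy[OF T eT]
    define B where "B = T - {{u, w}}"
    have uw: "\<not> linked B u w" using dich[OF uwV(2)] by (auto simp: B_def)
    have "\<exists>s\<in>V. \<not> linked B b s" using uw uwV unfolding linked_iff_cluster by metis
    moreover have "linked B x y" if "x \<in> V" "y \<in> V" "\<not> linked B b x" "\<not> linked B b y" for x y
      using dich[OF marked] dich[OF that(1)] dich[OF that(2)] that(3,4)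
      unfolding B_def[symmetric] unfolding linked_iff_cluster by metis
    moreover have "all_bridges B" "B \<subseteq> E"
      using T all_bridges_mono[of T B] by (auto simp: spanning_tree_iff B_def)
    ultimately have "B \<in> two_forests V E" by (auto simp: two_forest_iff)
    then show "T - {{u, w}} \<in> two_forests V E \<and> \<not> linked (T - {{u, w}}) u w"
      using uw by (simp add: B_def)
  qed
qed

definition both_floating :: "'a set set \<Rightarrow> 'a \<Rightarrow> 'a \<Rightarrow> real" where
  "both_floating B x y = of_bool (\<not> linked B b x \<and> \<not> linked B b y)"

definition floating_weight :: "'a \<Rightarrow> 'a \<Rightarrow> real" where
  "floating_weight x y = (\<Sum>B\<in>two_forests V E. weight c B * both_floating B x y)"

text \<open>In \<open>B\<close> exactly one of \<open>u\<close> and \<open>w\<close> is linked to \<open>b\<close>. If \<open>w\<close> is, then \<open>u\<close> floats, and \<open>v\<close>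
  floats with it unless \<open>v\<close> is linked to \<open>w\<close>; if \<open>u\<close> is, then \<open>w\<close> floats, and \<open>v\<close> floats with it
  exactly if it is linked to \<open>w\<close>.\<close>

lemma both_floating_difference:
  assumes T: "T \<in> spanning_trees V E" and e: "{u, w} \<in> T" and v: "v \<in> V"
  defines "B \<equiv> T - {{u, w}}"
  shows "both_floating B u v - both_floating B w v = of_bool (linked B w b) - of_bool (linked B w v)"
proof -
  note dich = tree_minus_edge_dichotomy[OF T e, folded B_def]
  have b: "linked B b u \<longleftrightarrow> \<not> linked B w b" "linked B b w \<longleftrightarrow> linked B w b"
    using dich[OF marked] unfolding linked_iff_cluster by metis+
  have "linked B b v \<longleftrightarrow> linked B w b = linked B w v"
    using dich[OF marked] dich[OF v] unfolding linked_iff_cluster by metis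
  then show ?thesis unfolding both_floating_def b by auto
qed

text \<open>Forests that link \<open>u\<close> and \<open>w\<close> cancel; the others correspond to the spanning trees through
  \<open>{u, w}\<close>, and the conductance of this edge is the missing factor of their weight.\<close>

lemma edge_contribution:
  assumes e: "{u, w} \<in> E"
  shows "c {u, w} * (floating_weight u v - floating_weight w v) =
    (\<Sum>T\<in>{T \<in> spanning_trees V E. {u, w} \<in> T}.
       weight c T * (both_floating (T - {{u, w}}) u v - both_floating (T - {{u, w}}) w v))"
proof -
  let ?d = "\<lambda>B. both_floating B u v - both_floating B w v"
  have "c {u, w} * (floating_weight u v - floating_weight w v)
      = (\<Sum>B\<in>two_forests V E. c {u, w} * weight c B * ?d B)"
    by (simp add: floating_weight_def sum_subtractf[symmetric] sum_distrib_left algebra_simps)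
  also have "\<dots> = (\<Sum>B\<in>{B \<in> two_forests V E. \<not> linked B u w}. c {u, w} * weight c B * ?d B)"
  proof (rule sum.mono_neutral_right[OF finite_two_forests])
    have "?d B = 0" if "linked B u w" for B
    proof -
      have "linked B b u \<longleftrightarrow> linked B b w" using that unfolding linked_iff_cluster by metis
      then show ?thesis by (simp add: both_floating_def)
    qed
    then show "\<forall>B\<in>two_forests V E - {B \<in> two_forests V E. \<not> linked B u w}.
        c {u, w} * weight c B * ?d B = 0" by auto
  qed auto
  also have "\<dots> = (\<Sum>B\<in>{B \<in> two_forests V E. \<not> linked B u w}.
      weight c (insert {u, w} B) * ?d (insert {u, w} B - {{u, w}}))"
  proof (rule sum.cong, rule refl)
    fix B assume B: "B \<in> {B \<in> two_forests V E. \<not> linked B u w}"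
    then have nB: "{u, w} \<notin> B" using linked_edge[of u w B] by auto
    have "finite B" using B finite_E by (auto simp: two_forest_iff intro: finite_subset)
    then show "c {u, w} * weight c B * ?d B
        = weight c (insert {u, w} B) * ?d (insert {u, w} B - {{u, w}})"
      using nB by (simp add: weight_def)
  qed
  also have "\<dots> = (\<Sum>T\<in>{T \<in> spanning_trees V E. {u, w} \<in> T}. weight c T * ?d (T - {{u, w}}))"
    by (rule sum.reindex_bij_betw[OF insert_edge_bij_betw[OF e]])
  finally show ?thesis .
qed

text \<open>Each spanning tree contributes its weight times the number of branches at \<open>u\<close> containing \<open>b\<close>
  minus the number of those containing \<open>v\<close>. The first number is \<open>1\<close> because \<open>u \<noteq> b\<close>; the second is
  \<open>0\<close> or \<open>1\<close> according to whether \<open>v = u\<close>.\<close>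

lemma laplacian_floating_weight:
  assumes u: "u \<in> V" "u \<noteq> b" and v: "v \<in> V"
  shows "laplacian V E c (\<lambda>x. floating_weight x v) u = kappa V E c * of_bool (u = v)"
proof -
  define N where "N = {w \<in> V. {u, w} \<in> E}"
  have finN: "finite N" using finite_V by (simp add: N_def)
  let ?d = "\<lambda>B w. both_floating B u v - both_floating B w v"
  have "laplacian V E c (\<lambda>x. floating_weight x v) u
      = (\<Sum>w\<in>N. \<Sum>T\<in>{T \<in> spanning_trees V E. {u, w} \<in> T}. weight c T * ?d (T - {{u, w}}) w)"
    unfolding laplacian_def N_def by (intro sum.cong refl edge_contribution) auto
  also have "\<dots> = (\<Sum>T\<in>spanning_trees V E. \<Sum>w\<in>{w \<in> N. {u, w} \<in> T}. weight c T * ?d (T - {{u, w}}) w)"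
    by (rule sum.swap_restrict[OF finN finite_spanning_trees])
  also have "\<dots> = (\<Sum>T\<in>spanning_trees V E. weight c T * of_bool (u = v))"
  proof (rule sum.cong, rule refl)
    fix T assume T: "T \<in> spanning_trees V E"
    then have TE: "T \<subseteq> E" and br: "all_bridges T" and conn: "\<And>x. x \<in> V \<Longrightarrow> linked T u x"
      using u(1) unfolding spanning_tree_iff linked_iff_cluster by metis+
    have nbrs: "{w \<in> N. {u, w} \<in> T} = {w. {u, w} \<in> T}"
      using TE edge_subset by (fastforce simp: N_def)
    then have fin: "finite {w. {u, w} \<in> T}" using finN by (metis finite_Collect_conjI Collect_mem_eq)
    have "(\<Sum>w\<in>{w \<in> N. {u, w} \<in> T}. weight c T * ?d (T - {{u, w}}) w)
        = (\<Sum>w\<in>{w. {u, w} \<in> T}. weight c T *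
            (of_bool (linked (T - {{u, w}}) w b) - of_bool (linked (T - {{u, w}}) w v)))"
      unfolding nbrs using both_floating_difference[OF T _ v] by (intro sum.cong) auto
    also have "\<dots> = weight c T * (of_bool (b \<noteq> u) - of_bool (v \<noteq> u))"
      using sum_branches[OF br conn[OF marked] fin] sum_branches[OF br conn[OF v] fin]
      by (simp add: sum_distrib_left[symmetric] sum_subtractf)
    also have "\<dots> = weight c T * of_bool (u = v)" using u(2) by auto
    finally show "(\<Sum>w\<in>{w \<in> N. {u, w} \<in> T}. weight c T * ?d (T - {{u, w}}) w)
        = weight c T * of_bool (u = v)" .
  qed
  also have "\<dots> = kappa V E c * of_bool (u = v)" by (simp add: kappa_def sum_distrib_right)
  finally show ?thesis .
qed

section \<open>The Green's function\<close>

text \<open>On functions vanishing at \<open>b\<close>, deleting the column of \<open>b\<close> from the Laplacian has no effect.\<close>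

lemma dirichlet_laplacian_apply:
  assumes u: "u \<in> V - {b}" and f: "f b = 0"
  shows "(\<Sum>k\<in>V - {b}. laplacian_matrix V E c u k * f k) = laplacian V E c f u"
proof -
  define N where "N = {w \<in> V. {u, w} \<in> E}"
  have pick: "(\<Sum>k\<in>V - {b}. indicator {k} x * f k) = f x" if "x \<in> V" for x
  proof -
    have "(\<Sum>k\<in>V - {b}. indicator {k} x * f k) = (\<Sum>k\<in>V - {b}. if k = x then f k else 0)"
      by (intro sum.cong) (auto simp: indicator_def)
    then show ?thesis using that f finite_V by auto
  qed
  have "(\<Sum>k\<in>V - {b}. laplacian_matrix V E c u k * f k)
      = (\<Sum>k\<in>V - {b}. \<Sum>w\<in>N. c {u, w} * (indicator {k} u * f k - indicator {k} w * f k))"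
    by (simp only: laplacian_matrix_def laplacian_def N_def sum_distrib_right left_diff_distrib mult.assoc)
  also have "\<dots> = (\<Sum>w\<in>N. \<Sum>k\<in>V - {b}. c {u, w} * (indicator {k} u * f k - indicator {k} w * f k))"
    by (rule sum.swap)
  also have "\<dots> = (\<Sum>w\<in>N. c {u, w} * (f u - f w))"
    using pick u by (intro sum.cong) (auto simp: sum_distrib_left[symmetric] sum_subtractf N_def)
  finally show ?thesis by (simp add: laplacian_def N_def)
qed

lemma laplacian_matrix_sym:
  assumes "u \<in> V" "v \<in> V"
  shows "laplacian_matrix V E c u v = laplacian_matrix V E c v u"
proof -
  have off: "laplacian_matrix V E c x y = (if {x, y} \<in> E then - c {x, y} else 0)"
    if "x \<noteq> y" "y \<in> V" for x y
  proof -
    have "laplacian_matrix V E c x y = (\<Sum>w\<in>{w \<in> V. {x, w} \<in> E}. if w = y then - c {x, w} else 0)"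
      unfolding laplacian_matrix_def laplacian_def
      using that by (intro sum.cong) (auto simp: indicator_def)
    then show ?thesis using that finite_V by simp
  qed
  show ?thesis using off[of u v] off[of v u] assms by (cases "u = v") (auto simp: insert_commute)
qed

lemma floating_weight_sym: "floating_weight x y = floating_weight y x"
  by (simp add: floating_weight_def both_floating_def conj_commute)

lemma floating_weight_marked: "floating_weight b y = 0"
  by (simp add: floating_weight_def both_floating_def)

text \<open>The product in one order is \<open>laplacian_floating_weight\<close>; the other order follows by
  transposition, as both matrices are symmetric.\<close>

lemma floating_weight_inverts_laplacian:
  "is_inverse_on (V - {b}) (laplacian_matrix V E c) (\<lambda>x y. floating_weight x y / kappa V E c)"
proof -
  have right: "(\<Sum>k\<in>V - {b}. laplacian_matrix V E c i k * (floating_weight k j / kappa V E c))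
      = (if i = j then 1 else 0)" if "i \<in> V - {b}" "j \<in> V - {b}" for i j
    using dirichlet_laplacian_apply[of i "\<lambda>x. floating_weight x j"]
      laplacian_floating_weight[of i j] that kappa_pos
    by (simp add: floating_weight_marked sum_divide_distrib[symmetric])
  have "(\<Sum>k\<in>V - {b}. floating_weight i k / kappa V E c * laplacian_matrix V E c k j)
      = (if i = j then 1 else 0)" if ij: "i \<in> V - {b}" "j \<in> V - {b}" for i j
  proof -
    have "(\<Sum>k\<in>V - {b}. floating_weight i k / kappa V E c * laplacian_matrix V E c k j)
        = (\<Sum>k\<in>V - {b}. laplacian_matrix V E c j k * (floating_weight k i / kappa V E c))"
      using ij by (intro sum.cong) (auto simp: laplacian_matrix_sym[of j] floating_weight_sym[of i])
    then show ?thesis using right[of j i] ij by auto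
  qed
  with right show ?thesis by (auto simp: is_inverse_on_def)
qed

lemma green_eq:
  assumes "u \<in> V" "v \<in> V"
  shows "green V E c b u v = floating_weight u v / kappa V E c"
proof (cases "u = b \<or> v = b")
  case True
  then show ?thesis
    using floating_weight_marked floating_weight_sym[of u v] by (auto simp: green_def)
next
  case False
  then show ?thesis
    using inverse_on_eq[OF _ floating_weight_inverts_laplacian, of u v] finite_V assms
    by (simp add: green_def)
qed

lemma prob_both_floating:
  assumes "u \<in> V" "v \<in> V"
  shows "\<P>(B in two_forest_measure V E c.
           u \<in> floating_component V b B \<and> v \<in> floating_component V b B)
       = floating_weight u v / kappa2 V E c"
proof -
  define S where "S = {B \<in> two_forests V E.
    u \<in> floating_component V b B \<and> v \<in> floating_component V b B}"
  have k2: "kappa2 V E c \<ge> 0"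
    unfolding kappa2_def using weight_pos
    by (intro sum_nonneg) (auto simp: two_forests_def intro: less_imp_le)
  have "\<P>(B in two_forest_measure V E c.
          u \<in> floating_component V b B \<and> v \<in> floating_component V b B)
      = measure (point_measure (two_forests V E) (\<lambda>B. ennreal (weight c B / kappa2 V E c))) S"
    by (simp add: two_forest_measure_def space_point_measure S_def)
  also have "\<dots> = (\<Sum>B\<in>S. weight c B / kappa2 V E c)"
  proof (subst measure_point_measure_finite_if)
    show "weight c B / kappa2 V E c \<ge> 0" if "B \<in> two_forests V E" for B
      using that weight_pos[of B] k2 by (auto simp: two_forests_def)
  qed (auto simp: S_def finite_two_forests)
  also have "\<dots> = (\<Sum>B\<in>two_forests V E. weight c B * both_floating B u v / kappa2 V E c)"
  proof (rule sum.mono_neutral_cong_left)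
    have *: "B \<in> S \<longleftrightarrow> \<not> linked B b u \<and> \<not> linked B b v" if "B \<in> two_forests V E" for B
      using that assms floating_component_eq[OF marked, of B] by (auto simp: S_def two_forests_def)
    show "S \<subseteq> two_forests V E" by (auto simp: S_def)
    show "\<forall>B\<in>two_forests V E - S. weight c B * both_floating B u v / kappa2 V E c = 0"
      using * by (auto simp: both_floating_def)
    show "weight c B / kappa2 V E c = weight c B * both_floating B u v / kappa2 V E c"
      if "B \<in> S" for B
      using * that by (auto simp: both_floating_def S_def)
  qed (rule finite_two_forests)
  also have "\<dots> = floating_weight u v / kappa2 V E c"
    by (simp add: floating_weight_def sum_divide_distrib)
  finally show ?thesis .
qed

end

theorem theorem3:
  fixes V :: "'a set" and E :: "'a set set" and c :: "'a set \<Rightarrow> real" and b :: 'a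
  assumes "finite_simple_graph V E"
    and "connected_graph V E"
    and "card V \<ge> 2"
    and "\<And>e. e \<in> E \<Longrightarrow> c e > 0"
    and "b \<in> V"
  shows "(\<forall>u\<in>V. \<P>(B in two_forest_measure V E c. u \<in> floating_component V b B)
            = kappa V E c / kappa2 V E c * green V E c b u u) \<and>
         (\<forall>u\<in>V. \<forall>v\<in>V. \<P>(B in two_forest_measure V E c.
              u \<in> floating_component V b B \<and> v \<in> floating_component V b B)
            = kappa V E c / kappa2 V E c * green V E c b u v)"
proof -
  interpret network V E c b
    using assms by unfold_locales auto
  have joint: "\<P>(B in two_forest_measure V E c.
        u \<in> floating_component V b B \<and> v \<in> floating_component V b B)
      = kappa V E c / kappa2 V E c * green V E c b u v" if "u \<in> V" "v \<in> V" for u v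
    using prob_both_floating[OF that] green_eq[OF that] kappa_pos by simp
  show ?thesis
    using joint joint[of u u for u] by simp
qed

end
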